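(* Let $q$ be a power of $2$, let $b,c\in\mathbb{F}_q$ and $d\in\mathbb{F}_{q^2}$. The polynomial $x^q+bx^2+cx+d\in\mathbb{F}_{q^2}[x]$ permutes $\mathbb{F}_{q^2}$ if and only if either ($b=0$ and $c\neq 1$) or ($b\neq 0$ and $c=1$).
   Context: $\mathbb{F}_q\subset\mathbb{F}_{q^2}$ are the finite fields with $q$ and $q^2$ elements. A polynomial permutes $\mathbb{F}_{q^2}$ if it induces a bijection of $\mathbb{F}_{q^2}$ onto itself. *)

theory Defs
  imports "HOL-Computational_Algebra.Polynomial" "HOL-Library.Cardinality"
begin

text \<open>A subset of a field type that is a field under the inherited operations.  Closure under
  subtraction together with \<open>1 \<in> K\<close> gives \<open>0 \<in> K\<close> and closure under negation and addition.\<close>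

definition is_subfield :: "'a::field set \<Rightarrow> bool" where
  "is_subfield K \<longleftrightarrow> 1 \<in> K \<and> (\<forall>x\<in>K. \<forall>y\<in>K. x - y \<in> K \<and> x * y \<in> K)
     \<and> (\<forall>x\<in>K. x \<noteq> 0 \<longrightarrow> inverse x \<in> K)"

definition permutation_poly :: "'a::{field, finite} poly \<Rightarrow> bool" where
  "permutation_poly p \<longleftrightarrow> bij (poly p)"

end

theory Submission imports Defs begin

text \<open>In characteristic 2, squaring is additive, hence so are the power \<open>q\<close> and
  \<open>L(x) = x^q + b x^2 + c x\<close>.  On a finite field, permuting
  is therefore the same as \<open>L\<close> having no nonzero root.  The roots are found by
  conjugation \<open>x \<mapsto> x^q\<close>, which is an involution of the big field fixing the
  small field, and so fixing \<open>b\<close> and \<open>c\<close>.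

  If \<open>b = 0\<close>, a root satisfies \<open>x^q = c x\<close>; conjugating gives \<open>x = c^2 x\<close>, so
  \<open>x \<noteq> 0\<close> forces \<open>c^2 = 1\<close>, that is \<open>c = 1\<close>; and \<open>c = 1\<close> does have the root \<open>1\<close>.
  If \<open>b \<noteq> 0\<close> and \<open>c = 1\<close>, a root satisfies \<open>x^q + x = b x^2\<close>, whose left side is
  invariant under conjugation; hence so is \<open>x^2\<close>, hence so is \<open>x\<close>, and then \<open>b x^2 = 0\<close>.
  If \<open>b \<noteq> 0\<close> and \<open>c \<noteq> 1\<close>, then \<open>(1 + c) / b\<close> is a nonzero root in the small field, where
  \<open>L(x) = x (1 + c + b x)\<close>.\<close>

lemma is_subfield_UNIV: "is_subfield (UNIV :: 'a::field set)"
  by (simp add: is_subfield_def)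

lemma is_subfield_add:
  assumes "is_subfield K" "x \<in> K" "y \<in> K"
  shows "x + y \<in> K"
proof -
  have diff: "u - v \<in> K" if "u \<in> K" "v \<in> K" for u v
    using assms(1) that by (simp add: is_subfield_def)
  have "x - ((y - y) - y) \<in> K"
    by (intro diff assms)
  then show ?thesis
    by simp
qed

text \<open>Multiplication by a nonzero \<open>x\<close> permutes the nonzero elements of \<open>K\<close>, so their product
  does not change when each of them is multiplied by \<open>x\<close>.\<close>

lemma is_subfield_power_card:
  fixes K :: "'a::field set"
  assumes K: "is_subfield K" and fin: "finite K" and x: "x \<in> K"
  shows "x ^ card K = x"
proof (cases "x = 0")
  case True
  then show ?thesis
    using fin x by (auto simp: card_gt_0_iff)
next
  case False
  let ?U = "K - {0}"
  have mult: "u * v \<in> K" if "u \<in> K" "v \<in> K" for u v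
    using K that by (simp add: is_subfield_def)
  have inj: "inj_on ((*) x) ?U"
    using False by (auto intro: inj_onI)
  moreover have "(*) x ` ?U \<subseteq> ?U"
    using x False mult by auto
  ultimately have image: "(*) x ` ?U = ?U"
    using fin by (simp add: endo_inj_surj)
  have "\<Prod>?U = (\<Prod>u\<in>?U. x * u)"
    using prod.reindex[OF inj, of "\<lambda>u. u"] image by simp
  also have "\<dots> = x ^ card ?U * \<Prod>?U"
    by (simp add: prod.distrib)
  finally have "x ^ card ?U = 1"
    using fin by simp
  moreover have "0 \<in> K"
    using K x by (metis is_subfield_def diff_self)
  then have "card K = Suc (card ?U)"
    by (rule card.remove[OF fin])
  ultimately show ?thesis
    by simp
qed

text \<open>Raising \<open>-1\<close> to the even power \<open>CARD('a)\<close> gives both \<open>1\<close> and \<open>-1\<close>.\<close>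

lemma two_eq_zero_if_even_card:
  assumes "even (CARD('a::{field, finite}))"
  shows "(1 :: 'a) + 1 = 0"
proof -
  have "(- 1 :: 'a) ^ CARD('a) = - 1"
    by (rule is_subfield_power_card[OF is_subfield_UNIV]) simp_all
  then have "(1 :: 'a) = - 1"
    using assms by simp
  then show ?thesis
    by (simp add: eq_neg_iff_add_eq_0)
qed

lemma add_power_two_power:
  fixes x y :: "'a::comm_ring_1"
  assumes "(1 :: 'a) + 1 = 0"
  shows "(x + y) ^ (2 ^ k) = x ^ (2 ^ k) + y ^ (2 ^ k)"
proof (induction k)
  case 0
  show ?case
    by simp
next
  case (Suc k)
  have two: "(2 :: 'a) = 0"
    using assms by simp
  have square: "(u + v)\<^sup>2 = u\<^sup>2 + v\<^sup>2" for u v :: 'a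
    by (simp add: power2_sum two)
  have "z ^ (2 ^ Suc k) = (z ^ (2 ^ k))\<^sup>2" for z :: 'a
    by (metis power_Suc2 power_mult)
  then show ?case
    using Suc square by simp
qed

text \<open>Conjugation \<open>x \<mapsto> x^q\<close> enters only through being additive, involutive and trivial
  on \<open>b\<close> and \<open>c\<close>.\<close>

lemma zero_if_linearized_root:
  fixes b c x :: "'a::field"
  assumes char2: "(1 :: 'a) + 1 = 0"
    and add: "\<And>u v :: 'a. (u + v) ^ q = u ^ q + v ^ q"
    and inv: "(x ^ q) ^ q = x"
    and b: "b ^ q = b" and c: "c ^ q = c"
    and cases: "(b = 0 \<and> c \<noteq> 1) \<or> (b \<noteq> 0 \<and> c = 1)"
    and root: "x ^ q + b * x\<^sup>2 + c * x = 0"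
  shows "x = 0"
proof -
  have two: "u + u = 0" for u :: 'a
    using char2 by (metis distrib_left mult.right_neutral mult_zero_right)
  have add_eq_0: "u = v" if "u + v = 0" for u v :: 'a
    using that two by (metis add_left_cancel)
  have square_eq: "u = v" if "u\<^sup>2 = v\<^sup>2" for u v :: 'a
    using that add_eq_0[of u v] by (auto simp: power2_eq_iff)
  from cases show ?thesis
  proof (elim disjE conjE)
    assume "b = 0" "c \<noteq> 1"
    then have conj: "x ^ q = c * x"
      using root add_eq_0 by simp
    have "x = (c * x) ^ q"
      using inv conj by simp
    also have "\<dots> = c\<^sup>2 * x"
      using c conj by (simp add: power_mult_distrib power2_eq_square)
    finally have "c\<^sup>2 = 1\<^sup>2 \<or> x = 0"
      by (metis mult_cancel_right2 power_one)
    then show ?thesis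
      using square_eq \<open>c \<noteq> 1\<close> by blast
  next
    assume "b \<noteq> 0" "c = 1"
    then have eq: "x ^ q + x = b * x\<^sup>2"
      using root add_eq_0[of "x ^ q + x" "b * x\<^sup>2"] by (simp add: ac_simps)
    have "b * x\<^sup>2 = (x ^ q + x) ^ q"
      using eq by (metis add inv add.commute)
    also have "\<dots> = b * (x ^ q)\<^sup>2"
      using eq b by (simp add: power_mult_distrib) (metis power_mult mult.commute)
    finally have "x = x ^ q"
      using square_eq \<open>b \<noteq> 0\<close> by simp
    then have "b * x\<^sup>2 = 0"
      using eq two by metis
    then show ?thesis
      using \<open>b \<noteq> 0\<close> by simp
  qed
qed

theorem mainTheorem6:
  fixes q :: nat
    and F :: "'a::{field, finite} set"
    and b c d :: 'a
  assumes "\<exists>k\<ge>1. q = 2 ^ k"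
    and "CARD('a) = q ^ 2"
    and "is_subfield F" and "card F = q"
    and "b \<in> F" and "c \<in> F"
  shows "permutation_poly (monom 1 q + monom b 2 + monom c 1 + monom d 0)
    \<longleftrightarrow> (b = 0 \<and> c \<noteq> 1) \<or> (b \<noteq> 0 \<and> c = 1)"
proof -
  define L where "L x = x ^ q + b * x\<^sup>2 + c * x" for x
  obtain k where k: "k \<ge> 1" "q = 2 ^ k"
    using assms(1) by blast
  have "even (CARD('a))"
    using k assms(2) by simp
  then have char2: "(1 :: 'a) + 1 = 0"
    by (rule two_eq_zero_if_even_card)
  have two: "u + u = 0" for u :: 'a
    using char2 by (metis distrib_left mult.right_neutral mult_zero_right)
  have minus: "u - v = u + v" for u v :: 'a
    using two[of v] by (simp add: diff_eq_eq add.assoc)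
  have add: "(u + v) ^ q = u ^ q + v ^ q" for u v :: 'a
    using add_power_two_power[OF char2] k by simp
  have square: "(u + v)\<^sup>2 = u\<^sup>2 + v\<^sup>2" for u v :: 'a
    using add_power_two_power[OF char2, of u v 1] by simp
  have inv: "(u ^ q) ^ q = u" for u :: 'a
    using is_subfield_power_card[OF is_subfield_UNIV, of u] assms(2)
    by (simp add: power2_eq_square power_mult)
  have fixed: "u ^ q = u" if "u \<in> F" for u
    using is_subfield_power_card[OF assms(3) _ that] assms(4) by simp
  have L_add: "L (u + v) = L u + L v" for u v
    by (simp add: L_def add square algebra_simps)
  have L_0: "L 0 = 0"
    using k by (simp add: L_def)
  have poly: "poly (monom 1 q + monom b 2 + monom c 1 + monom d 0) x = L x + d" for x
    by (simp add: L_def poly_monom)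
  have "permutation_poly (monom 1 q + monom b 2 + monom c 1 + monom d 0) \<longleftrightarrow> inj L"
    using finite_UNIV_inj_surj[OF finite, of "\<lambda>x. L x + d"]
    unfolding permutation_poly_def bij_def inj_def poly by auto
  also have "\<dots> \<longleftrightarrow> (\<forall>x. L x = 0 \<longrightarrow> x = 0)"
  proof
    assume "inj L"
    then show "\<forall>x. L x = 0 \<longrightarrow> x = 0"
      using L_0 by (metis injD)
  next
    assume kernel: "\<forall>x. L x = 0 \<longrightarrow> x = 0"
    show "inj L"
    proof (rule injI)
      fix u v
      assume "L u = L v"
      then have "L (u - v) = 0"
        by (simp add: minus L_add two)
      then show "u = v"
        using kernel by (metis right_minus_eq)
    qed
  qed
  also have "\<dots> \<longleftrightarrow> (b = 0 \<and> c \<noteq> 1) \<or> (b \<noteq> 0 \<and> c = 1)"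
  proof
    assume kernel: "\<forall>x. L x = 0 \<longrightarrow> x = 0"
    have "c \<noteq> 1" if "b = 0"
    proof
      assume "c = 1"
      then have "L 1 = 0"
        using that char2 by (simp add: L_def)
      then show False
        using kernel by auto
    qed
    moreover have "c = 1" if "b \<noteq> 0"
    proof -
      let ?r = "(1 + c) / b"
      have "1 + c \<in> F"
        using assms(3,6) by (intro is_subfield_add) (simp_all add: is_subfield_def)
      then have "?r \<in> F"
        using assms(3,5) that by (simp add: is_subfield_def divide_inverse)
      then have "L ?r = ?r * ((1 + c) + b * ?r)"
        using fixed by (simp add: L_def power2_eq_square algebra_simps)
      also have "\<dots> = 0"
        using that two[of "1 + c"] by simp
      finally have "?r = 0"
        using kernel by blast
      then have "1 - c = 0"
        using that by (simp add: minus)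
      then show ?thesis
        by simp
    qed
    ultimately show "(b = 0 \<and> c \<noteq> 1) \<or> (b \<noteq> 0 \<and> c = 1)"
      by blast
  next
    assume "(b = 0 \<and> c \<noteq> 1) \<or> (b \<noteq> 0 \<and> c = 1)"
    then show "\<forall>x. L x = 0 \<longrightarrow> x = 0"
      using zero_if_linearized_root[OF char2 add inv fixed fixed] assms(5,6)
      unfolding L_def by blast
  qed
  finally show ?thesis .
qed

end
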